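(* Let $\Gamma\subset SL_2(\mathbb R)$ be a Fuchsian group of the first kind, let $\chi$ be a character of $\Gamma$ of finite order, and let $m\ge1$. Then, for any sequence $f_1,\ldots,f_k\in M_m(\Gamma,\chi)$, the Wronskian $$W(f_1,\ldots,f_k)(z)=\left|\begin{matrix} f_1(z)&\cdots&f_k(z)\\ \frac{df_1(z)}{dz}&\cdots&\frac{df_k(z)}{dz}\\ &\cdots&\\ \frac{d^{k-1}f_1(z)}{dz^{k-1}}&\cdots&\frac{d^{k-1}f_k(z)}{dz^{k-1}}\end{matrix}\right|$$ is a cuspidal modular form in $S_{k(m+k-1)}(\Gamma,\chi^k)$ if $k\ge2$. If $f_1,\ldots,f_k$ are linearly independent, then $W(f_1,\ldots,f_k)\ne0$.
   Context: A Fuchsian group of the first kind is a discrete subgroup $\Gamma\subset SL_2(\mathbb R)$ with $\iint_{\Gamma\backslash\mathbb H} dx\,dy/y^2<\infty$, where $\mathbb H$ is the upper half-plane. For $g=\begin{pmatrix}a&b\\c&d\end{pmatrix}\in SL_2(\mathbb R)$ put $j(g,z)=cz+d$. For a character $\chi:\Gamma\to\mathbb C^\times$ of finite order, $M_m(\Gamma,\chi)$ (resp. $S_m(\Gamma,\chi)$) is the space of holomorphic $f:\mathbb H\to\mathbb C$ with $f(\gamma.z)=\chi(\gamma)j(\gamma,z)^m f(z)$ for all $\gamma\in\Gamma$, $z\in\mathbb H$, that are holomorphic (resp. holomorphic and vanishing) at every cusp of $\Gamma$. *)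

theory Defs
  imports
    "Jordan_Normal_Form.Determinant"
    "HOL-Complex_Analysis.Complex_Analysis"
begin

(* Elements of SL_2(R) are matrices of HOL-Analysis (type real ^ 2 ^ 2, with its topology);
   the Wronskian is a determinant of varying size k, hence one of Jordan_Normal_Form.
   The unqualified notation below is that of HOL-Analysis. *)
no_notation Matrix.vec_index (infixl "$" 100)
no_notation fps_nth (infixl "$" 75)
hide_const (open) Matrix.mat Determinant.det

definition SL2R :: "(real ^ 2 ^ 2) monoid" where
  "SL2R = \<lparr>carrier = {A. det A = 1}, mult = (**), one = mat 1\<rparr>"

lemma group_SL2R: "group SL2R"
proof (rule groupI)
  fix x assume "x \<in> carrier SL2R"
  then have x: "det x = 1"
    by (simp add: SL2R_def)
  then have "invertible x"
    by (simp add: invertible_det_nz)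
  then obtain y where y: "y ** x = mat 1"
    unfolding invertible_def by blast
  have "det y = 1"
    using arg_cong[OF y, of det] x by (simp add: det_mul)
  with y show "\<exists>y\<in>carrier SL2R. y \<otimes>\<^bsub>SL2R\<^esub> x = \<one>\<^bsub>SL2R\<^esub>"
    unfolding SL2R_def by force
qed (simp_all add: SL2R_def det_mul matrix_mul_assoc)

definition Cstar :: "complex monoid" where
  "Cstar = \<lparr>carrier = - {0}, mult = (*), one = 1\<rparr>"

definition UHP :: "complex set" where
  "UHP = {z. Im z > 0}"

definition mob :: "real ^ 2 ^ 2 \<Rightarrow> complex \<Rightarrow> complex" where
  "mob g = moebius (of_real (g $ 1 $ 1)) (of_real (g $ 1 $ 2))
                   (of_real (g $ 2 $ 1)) (of_real (g $ 2 $ 2))"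

definition autj :: "real ^ 2 ^ 2 \<Rightarrow> complex \<Rightarrow> complex" where
  "autj g z = of_real (g $ 2 $ 1) * z + of_real (g $ 2 $ 2)"

(* dx dy / y^2 on the upper half-plane *)
definition hyp_area :: "complex measure" where
  "hyp_area = density lborel (\<lambda>z. indicator UHP z * ennreal (1 / (Im z)\<^sup>2))"

(* The area of the quotient of UHP by Gamma is the hyperbolic area of a Borel set meeting every
   orbit exactly once. For a discrete subgroup such a set exists, and its area does not depend
   on the choice. *)
definition fuchsian_first_kind :: "(real ^ 2 ^ 2) set \<Rightarrow> bool" where
  "fuchsian_first_kind \<Gamma> \<longleftrightarrow>
     subgroup \<Gamma> SL2R \<and> discrete \<Gamma> \<and>
     (\<exists>F. F \<in> sets borel \<and> F \<subseteq> UHP \<and>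
          (\<forall>z\<in>UHP. \<exists>!w. w \<in> F \<and> (\<exists>\<gamma>\<in>\<Gamma>. w = mob \<gamma> z)) \<and>
          emeasure hyp_area F < \<infinity>)"

definition finite_order_character :: "(real ^ 2 ^ 2) set \<Rightarrow> (real ^ 2 ^ 2 \<Rightarrow> complex) \<Rightarrow> bool" where
  "finite_order_character \<Gamma> chi \<longleftrightarrow>
     chi \<in> hom (SL2R\<lparr>carrier := \<Gamma>\<rparr>) Cstar \<and> (\<exists>n>0. \<forall>\<gamma>\<in>\<Gamma>. chi \<gamma> ^ n = 1)"

(* Action on the boundary, the reals together with infinity; None stands for infinity. *)
definition bdry_act :: "real ^ 2 ^ 2 \<Rightarrow> real option \<Rightarrow> real option" where
  "bdry_act g x =
     (case x of
        None \<Rightarrow> if g $ 2 $ 1 = 0 then None else Some (g $ 1 $ 1 / g $ 2 $ 1)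
      | Some t \<Rightarrow> if g $ 2 $ 1 * t + g $ 2 $ 2 = 0 then None
                  else Some (moebius (g $ 1 $ 1) (g $ 1 $ 2) (g $ 2 $ 1) (g $ 2 $ 2) t))"

definition parabolic :: "real ^ 2 ^ 2 \<Rightarrow> bool" where
  "parabolic g \<longleftrightarrow> det g = 1 \<and> \<bar>trace g\<bar> = 2 \<and> g \<noteq> mat 1 \<and> g \<noteq> - mat 1"

definition cusps :: "(real ^ 2 ^ 2) set \<Rightarrow> real option set" where
  "cusps \<Gamma> = {x. \<exists>\<gamma>\<in>\<Gamma>. parabolic \<gamma> \<and> bdry_act \<gamma> x = x}"

definition slash :: "nat \<Rightarrow> (complex \<Rightarrow> complex) \<Rightarrow> real ^ 2 ^ 2 \<Rightarrow> complex \<Rightarrow> complex" where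
  "slash m f \<sigma> z = f (mob \<sigma> z) / autj \<sigma> z ^ m"

definition transl :: "real \<Rightarrow> real ^ 2 ^ 2" where
  "transl h = vector [vector [1, h], vector [0, 1]]"

(* f | sigma has period h because the conjugate of the translation by h lies in the kernel of chi
   (a subgroup of finite index in Gamma, so such h > 0 exist at every cusp). *)
definition fourier_expansion ::
  "nat \<Rightarrow> (real ^ 2 ^ 2) set \<Rightarrow> (real ^ 2 ^ 2 \<Rightarrow> complex) \<Rightarrow> (complex \<Rightarrow> complex) \<Rightarrow>
   real ^ 2 ^ 2 \<Rightarrow> real \<Rightarrow> (nat \<Rightarrow> complex) \<Rightarrow> bool" where
  "fourier_expansion m \<Gamma> chi f \<sigma> h a \<longleftrightarrow>
     h > 0 \<and> \<sigma> ** transl h ** matrix_inv \<sigma> \<in> {\<gamma> \<in> \<Gamma>. chi \<gamma> = 1} \<and>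
     (\<forall>z\<in>UHP. (\<lambda>n. a n * exp (2 * of_real pi * \<i> * of_nat n * z / of_real h)) sums slash m f \<sigma> z)"

definition holomorphic_at_cusp ::
  "nat \<Rightarrow> (real ^ 2 ^ 2) set \<Rightarrow> (real ^ 2 ^ 2 \<Rightarrow> complex) \<Rightarrow> (complex \<Rightarrow> complex) \<Rightarrow> real option \<Rightarrow> bool" where
  "holomorphic_at_cusp m \<Gamma> chi f x \<longleftrightarrow>
     (\<forall>\<sigma>\<in>carrier SL2R. bdry_act \<sigma> None = x \<longrightarrow> (\<exists>h a. fourier_expansion m \<Gamma> chi f \<sigma> h a))"

definition vanishes_at_cusp ::
  "nat \<Rightarrow> (real ^ 2 ^ 2) set \<Rightarrow> (real ^ 2 ^ 2 \<Rightarrow> complex) \<Rightarrow> (complex \<Rightarrow> complex) \<Rightarrow> real option \<Rightarrow> bool" where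
  "vanishes_at_cusp m \<Gamma> chi f x \<longleftrightarrow>
     (\<forall>\<sigma>\<in>carrier SL2R. bdry_act \<sigma> None = x \<longrightarrow>
        (\<exists>h a. fourier_expansion m \<Gamma> chi f \<sigma> h a \<and> a 0 = 0))"

(* Functions on UHP are represented by total functions whose values off UHP are irrelevant. *)
definition modular_forms ::
  "nat \<Rightarrow> (real ^ 2 ^ 2) set \<Rightarrow> (real ^ 2 ^ 2 \<Rightarrow> complex) \<Rightarrow> (complex \<Rightarrow> complex) set" where
  "modular_forms m \<Gamma> chi =
     {f. f holomorphic_on UHP \<and>
         (\<forall>\<gamma>\<in>\<Gamma>. \<forall>z\<in>UHP. f (mob \<gamma> z) = chi \<gamma> * autj \<gamma> z ^ m * f z) \<and>
         (\<forall>x\<in>cusps \<Gamma>. holomorphic_at_cusp m \<Gamma> chi f x)}"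

definition cusp_forms ::
  "nat \<Rightarrow> (real ^ 2 ^ 2) set \<Rightarrow> (real ^ 2 ^ 2 \<Rightarrow> complex) \<Rightarrow> (complex \<Rightarrow> complex) set" where
  "cusp_forms m \<Gamma> chi =
     {f \<in> modular_forms m \<Gamma> chi. \<forall>x\<in>cusps \<Gamma>. vanishes_at_cusp m \<Gamma> chi f x}"

definition wronskian :: "nat \<Rightarrow> (nat \<Rightarrow> complex \<Rightarrow> complex) \<Rightarrow> complex \<Rightarrow> complex" where
  "wronskian k f z = Determinant.det (Matrix.mat k k (\<lambda>(i, j). (deriv ^^ i) (f j) z))"

definition lin_indep_on_UHP :: "nat \<Rightarrow> (nat \<Rightarrow> complex \<Rightarrow> complex) \<Rightarrow> bool" where
  "lin_indep_on_UHP k f \<longleftrightarrow>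
     (\<forall>c. (\<forall>z\<in>UHP. (\<Sum>j<k. c j * f j z) = 0) \<longrightarrow> (\<forall>j<k. c j = (0::complex)))"

end

theory Submission
  imports Defs
begin

text \<open>
  Everything rests on how a Wronskian behaves when all functions undergo the same substitution.
  By the product and chain rules, the $i$-th derivative of $u \cdot (g \circ \varphi)$ is a
  combination of the functions $g^{(l)} \circ \varphi$ with $l \le i$, whose coefficients do
  not involve $g$ and whose leading one is $u\,(\varphi')^i$. Hence the Wronskian matrix of the
  functions $u \cdot (f_j \circ \varphi)$ is a lower triangular matrix times that of the $f_j$,
  taken at $\varphi(z)$, and (\<open>wronskian_substitution\<close>)
  $$W(u \cdot (f_j \circ \varphi)) = u^k\,(\varphi')^{k(k-1)/2}\; W(f_j) \circ \varphi.$$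

  For $\varphi = \sigma \in SL_2(R)$ and $u = j(\sigma, z)^{-m}$, the derivative
  $\sigma' = j(\sigma, z)^{-2}$ contributes $k(k-1)$ to the weight, so the Wronskian commutes
  with the slash operators of weights $m$ and $mk + k(k-1) = k(m+k-1)$
  (\<open>wronskian_slash\<close>). Applied to $\gamma \in \Gamma$ this is the modular
  transformation law, with character $\chi^k$.

  Applied to a $\sigma$ that sends $\infty$ to a cusp, it reduces the behaviour at that cusp to the
  Wronskian of the functions $F_j = f_j|\sigma$. Each $F_j$ has a limit as
  $\mathrm{Im}\, z \to \infty$, the constant term of its expansion, so by the Cauchy estimates on
  discs of radius $1$ all derivatives of positive order tend to $0$. For $k \ge 2$ every term of the
  determinant contains a factor from the row of first derivatives, so the Wronskian tends to $0$
  (\<open>wronskian_tendsto_0\<close>). The expansions of the $F_j$ may have different periods, so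
  they serve only to find these limits: the transformation law makes $W|\sigma$ periodic for the
  period of any one of the $F_j$, and a periodic function with a limit at $i\infty$ is a power
  series in the nome by the removable singularity theorem
  (\<open>fourier_series_of_periodic\<close>), with that limit as constant term.

  The last claim holds for holomorphic functions on any connected open set
  (\<open>wronskian_eq_0_imp_dependent\<close>), by induction on $k$: dividing by $f_0$ turns the
  Wronskian of $k+1$ functions into that of the $k$ derivatives $(f_j/f_0)'$.
\<close>

section \<open>Wronskians under substitution\<close>

text \<open>The coefficient of $g^{(l)} \circ \varphi$ in the $i$-th derivative of
  $u \cdot (g \circ \varphi)$; the recursion is what one more application of the product and chain
  rules does to these coefficients.\<close>

primrec chain_coeff ::
  "(complex \<Rightarrow> complex) \<Rightarrow> (complex \<Rightarrow> complex) \<Rightarrow> nat \<Rightarrow> nat \<Rightarrow> complex \<Rightarrow> complex" where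
  "chain_coeff u \<phi> 0 = (\<lambda>l. if l = 0 then u else (\<lambda>_. 0))"
| "chain_coeff u \<phi> (Suc i) =
     (\<lambda>l z. deriv (chain_coeff u \<phi> i l) z
            + (if l = 0 then 0 else chain_coeff u \<phi> i (l - 1) z * deriv \<phi> z))"

lemma chain_coeff_above: "i < l \<Longrightarrow> chain_coeff u \<phi> i l = (\<lambda>_. 0)"
  by (induction i arbitrary: l) auto

lemma chain_coeff_diag: "chain_coeff u \<phi> i i z = u z * deriv \<phi> z ^ i"
  by (induction i) (simp_all add: chain_coeff_above)

lemma chain_coeff_holomorphic:
  assumes "open S" "u holomorphic_on S" "\<phi> holomorphic_on S"
  shows "chain_coeff u \<phi> i l holomorphic_on S"
  using assms
proof (induction i arbitrary: l)
  case (Suc i)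
  then show ?case
    by (cases "l = 0") (auto intro!: holomorphic_intros)
qed auto

lemma higher_deriv_substitution:
  assumes S: "open S" and T: "open T"
    and u: "u holomorphic_on S" and \<phi>: "\<phi> holomorphic_on S" and \<phi>S: "\<phi> ` S \<subseteq> T"
    and g: "g holomorphic_on T" and z: "z \<in> S"
  shows "(deriv ^^ i) (\<lambda>z. u z * g (\<phi> z)) z =
         (\<Sum>l\<le>i. chain_coeff u \<phi> i l z * (deriv ^^ l) g (\<phi> z))"
  using z
proof (induction i arbitrary: z)
  case (Suc i)
  let ?A = "chain_coeff u \<phi>"
  let ?D = "\<lambda>l. (deriv ^^ l) g"
  have A: "?A i l holomorphic_on S" for l
    by (rule chain_coeff_holomorphic[OF S u \<phi>])
  have D: "?D l holomorphic_on T" for l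
    by (rule holomorphic_higher_deriv[OF g T])
  have D\<phi>: "(\<lambda>z. ?D l (\<phi> z)) holomorphic_on S" for l
    using holomorphic_on_compose_gen[OF \<phi> D \<phi>S] by (simp add: o_def)
  have F: "(\<lambda>z. u z * g (\<phi> z)) holomorphic_on S"
    using D\<phi>[of 0] u by (auto intro!: holomorphic_intros)
  have dA: "(?A i l has_field_derivative deriv (?A i l) z) (at z)" for l
    using A S Suc.prems by (rule holomorphic_derivI)
  have d\<phi>: "(\<phi> has_field_derivative deriv \<phi> z) (at z)"
    using \<phi> S Suc.prems by (rule holomorphic_derivI)
  have dD: "(?D l has_field_derivative ?D (Suc l) (\<phi> z)) (at (\<phi> z))" for l
    using has_field_derivative_higher_deriv[OF g T] \<phi>S Suc.prems by blast
  have dD\<phi>: "((\<lambda>z. ?D l (\<phi> z)) has_field_derivative ?D (Suc l) (\<phi> z) * deriv \<phi> z) (at z)" for l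
    using DERIV_chain2[OF dD d\<phi>] .
  have "(deriv ^^ Suc i) (\<lambda>z. u z * g (\<phi> z)) z
          = deriv ((deriv ^^ i) (\<lambda>z. u z * g (\<phi> z))) z"
    by simp
  also have "\<dots> = deriv (\<lambda>z. \<Sum>l\<le>i. ?A i l z * ?D l (\<phi> z)) z"
    using Suc by (intro complex_derivative_transform_within_open[OF _ _ S])
      (auto intro!: holomorphic_intros F S A D\<phi>)
  also have "\<dots> = (\<Sum>l\<le>i. deriv (?A i l) z * ?D l (\<phi> z)
                        + ?D (Suc l) (\<phi> z) * deriv \<phi> z * ?A i l z)"
    by (intro DERIV_imp_deriv DERIV_sum DERIV_mult dA dD\<phi>)
  also have "\<dots> = (\<Sum>l\<le>i. deriv (?A i l) z * ?D l (\<phi> z))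
                  + (\<Sum>l\<le>i. ?A i l z * deriv \<phi> z * ?D (Suc l) (\<phi> z))"
    by (simp add: sum.distrib mult_ac)
  also have "(\<Sum>l\<le>i. deriv (?A i l) z * ?D l (\<phi> z))
               = (\<Sum>l\<le>Suc i. deriv (?A i l) z * ?D l (\<phi> z))"
    by (simp add: chain_coeff_above)
  also have "(\<Sum>l\<le>i. ?A i l z * deriv \<phi> z * ?D (Suc l) (\<phi> z))
               = (\<Sum>l\<le>Suc i. (if l = 0 then 0 else ?A i (l - 1) z * deriv \<phi> z) * ?D l (\<phi> z))"
    by (subst sum.atMost_Suc_shift) simp
  finally show ?case
    by (simp only: sum.distrib[symmetric] chain_coeff.simps distrib_right)
qed simp

text \<open>The row operations that express the derivatives of $u \cdot (g \circ \varphi)$ by those of $g$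
  are the same for every $g$, so they form one left factor of the matrix; being lower triangular,
  its determinant is the product of the entries $u\,(\varphi')^i$.\<close>

lemma wronskian_substitution:
  assumes S: "open S" and T: "open T"
    and u: "u holomorphic_on S" and \<phi>: "\<phi> holomorphic_on S" and \<phi>S: "\<phi> ` S \<subseteq> T"
    and f: "\<And>j. j < k \<Longrightarrow> f j holomorphic_on T" and z: "z \<in> S"
  shows "wronskian k (\<lambda>j z. u z * f j (\<phi> z)) z =
         u z ^ k * deriv \<phi> z ^ (\<Sum>i<k. i) * wronskian k f (\<phi> z)"
proof -
  define A where "A = Matrix.mat k k (\<lambda>(i, l). chain_coeff u \<phi> i l z)"
  define B where "B = Matrix.mat k k (\<lambda>(l, j). (deriv ^^ l) (f j) (\<phi> z))"
  have A[simp]: "A \<in> carrier_mat k k" and B[simp]: "B \<in> carrier_mat k k"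
    by (simp_all add: A_def B_def)
  have "Matrix.mat k k (\<lambda>(i, j). (deriv ^^ i) (\<lambda>z. u z * f j (\<phi> z)) z) = A * B"
  proof (rule eq_matI)
    fix i j assume "i < dim_row (A * B)" "j < dim_col (A * B)"
    then have ij: "i < k" "j < k"
      by (simp_all add: A_def B_def)
    have "(deriv ^^ i) (\<lambda>z. u z * f j (\<phi> z)) z
            = (\<Sum>l\<le>i. chain_coeff u \<phi> i l z * (deriv ^^ l) (f j) (\<phi> z))"
      using higher_deriv_substitution[OF S T u \<phi> \<phi>S f z] ij by blast
    also have "\<dots> = (\<Sum>l\<in>{0..<k}. chain_coeff u \<phi> i l z * (deriv ^^ l) (f j) (\<phi> z))"
      using ij by (intro sum.mono_neutral_left) (auto simp: chain_coeff_above)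
    finally show "Matrix.mat k k (\<lambda>(i, j). (deriv ^^ i) (\<lambda>z. u z * f j (\<phi> z)) z) $$ (i, j)
                    = (A * B) $$ (i, j)"
      using ij by (simp add: A_def B_def scalar_prod_def)
  qed (simp_all add: A_def B_def)
  then have "wronskian k (\<lambda>j z. u z * f j (\<phi> z)) z = Determinant.det A * Determinant.det B"
    by (simp add: wronskian_def Determinant.det_mult[OF A B])
  moreover have "Determinant.det A = prod_list (diag_mat A)"
    by (rule det_lower_triangular[OF _ A]) (auto simp: A_def chain_coeff_above)
  then have "Determinant.det A = (\<Prod>i<k. u z * deriv \<phi> z ^ i)"
    by (simp add: prod_list_diag_prod A_def chain_coeff_diag lessThan_atLeast0)
  then have "Determinant.det A = u z ^ k * deriv \<phi> z ^ (\<Sum>i<k. i)"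
    by (simp add: prod.distrib power_sum)
  ultimately show ?thesis
    by (simp add: wronskian_def B_def)
qed

lemma wronskian_cong_open:
  assumes "open S" "z \<in> S"
    and "\<And>j. j < k \<Longrightarrow> f j holomorphic_on S"
    and "\<And>j w. j < k \<Longrightarrow> w \<in> S \<Longrightarrow> f j w = g j w"
  shows "wronskian k f z = wronskian k g z"
proof -
  have "(deriv ^^ i) (f j) z = (deriv ^^ i) (g j) z" if "j < k" for i j
  proof (rule higher_deriv_transform_within_open)
    show "g j holomorphic_on S"
      using holomorphic_transform[OF assms(3)] assms(4) that by blast
  qed (use assms that in auto)
  then have "Matrix.mat k k (\<lambda>(i, j). (deriv ^^ i) (f j) z)
           = Matrix.mat k k (\<lambda>(i, j). (deriv ^^ i) (g j) z)"
    by (intro cong_mat) auto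
  then show ?thesis
    by (simp add: wronskian_def)
qed

lemma wronskian_scale:
  assumes "open S" "z \<in> S" "\<And>j. j < k \<Longrightarrow> f j holomorphic_on S"
  shows "wronskian k (\<lambda>j z. c * f j z) z = c ^ k * wronskian k f z"
  using wronskian_substitution[of S S "\<lambda>_. c" "\<lambda>z. z" k f z] assms by simp

lemma wronskian_sum_over_permutations:
  "wronskian k f z = (\<Sum>p | p permutes {0..<k}. signof p * (\<Prod>i = 0..<k. (deriv ^^ i) (f (p i)) z))"
proof -
  have "p i < k" if "p permutes {0..<k}" "i < k" for p i
    using permutes_in_image[OF that(1), of i] that(2) by simp
  then show ?thesis
    unfolding wronskian_def
    by (subst det_def'[of _ k]) (auto intro!: sum.cong prod.cong)
qed

lemma wronskian_holomorphic:
  assumes "open S" "\<And>j. j < k \<Longrightarrow> f j holomorphic_on S"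
  shows "wronskian k f holomorphic_on S"
proof -
  have "p i < k" if "p permutes {0..<k}" "i < k" for p i
    using permutes_in_image[OF that(1), of i] that(2) by simp
  then show ?thesis
    unfolding wronskian_sum_over_permutations[abs_def]
    using assms by (auto intro!: holomorphic_intros)
qed

section \<open>Vanishing Wronskians and linear dependence\<close>

text \<open>The first column is $(1, 0, \ldots, 0)$, so the Laplace expansion along it has a single term, in
  which every remaining function appears from its first derivative on.\<close>

lemma wronskian_Suc_one:
  assumes "f 0 = (\<lambda>_. 1)"
  shows "wronskian (Suc k) f z = wronskian k (\<lambda>j. deriv (f (Suc j))) z"
proof -
  define M where "M = Matrix.mat (Suc k) (Suc k) (\<lambda>(i, j). (deriv ^^ i) (f j) z)"
  have M: "M \<in> carrier_mat (Suc k) (Suc k)"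
    by (simp add: M_def)
  have "Determinant.det M = (\<Sum>i<Suc k. M $$ (i, 0) * cofactor M i 0)"
    by (rule laplace_expansion_column[OF M]) simp
  also have "\<dots> = (\<Sum>i<Suc k. if i = 0 then cofactor M 0 0 else 0)"
    by (intro sum.cong) (auto simp: M_def assms)
  also have "\<dots> = Determinant.det (mat_delete M 0 0)"
    by (simp add: cofactor_def)
  also have "mat_delete M 0 0 = Matrix.mat k k (\<lambda>(i, j). (deriv ^^ i) (deriv (f (Suc j))) z)"
    unfolding mat_delete_def
    by (rule eq_matI) (auto simp: M_def funpow_swap1)
  finally show ?thesis
    by (simp add: wronskian_def M_def)
qed

text \<open>Unless $f_0$ vanishes identically, it has no zero on some ball. There, taking out $f_0$ leaves the
  functions $1, f_1/f_0, \ldots$, and the induction hypothesis gives a relation between the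
  derivatives of the quotients. A relation between the quotients holds up to a constant, which
  becomes the coefficient of $f_0$; the identity theorem carries the result to all of $S$. The
  induction therefore has to range over all connected open sets.\<close>

lemma wronskian_eq_0_imp_dependent:
  assumes "open S" "connected S" "S \<noteq> {}"
    and "\<And>j. j < k \<Longrightarrow> f j holomorphic_on S"
    and "\<And>z. z \<in> S \<Longrightarrow> wronskian k f z = 0"
  shows "\<exists>c. (\<exists>j<k. c j \<noteq> 0) \<and> (\<forall>z\<in>S. (\<Sum>j<k. c j * f j z) = 0)"
  using assms
proof (induction k arbitrary: S f)
  case 0
  then show ?case
    by (auto simp: wronskian_def)
next
  case (Suc k)
  note S = Suc.prems(1-3) and f = Suc.prems(4) and W = Suc.prems(5)
  show ?case
  proof (cases "\<forall>z\<in>S. f 0 z = 0")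
    case True
    then show ?thesis
      by (intro exI[of _ "\<lambda>j. if j = 0 then 1 else 0"]) (auto intro!: sum.neutral)
  next
    case False
    then obtain z0 where z0: "z0 \<in> S" "f 0 z0 \<noteq> 0"
      by blast
    have op: "open (S \<inter> f 0 -` (- {0}))"
      using holomorphic_on_imp_continuous_on[OF f[of 0]] S(1)
      by (intro continuous_open_preimage) auto
    obtain r where r: "r > 0" "ball z0 r \<subseteq> S \<inter> f 0 -` (- {0})"
      by (rule openE[OF op, of z0]) (use z0 in auto)
    define B where "B = ball z0 r"
    have B: "open B" "connected B" "B \<noteq> {}" "B \<subseteq> S"
      using r by (auto simp: B_def)
    have nz: "f 0 z \<noteq> 0" if "z \<in> B" for z
      using r that by (auto simp: B_def)
    have fB: "f j holomorphic_on B" if "j < Suc k" for j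
      using f[OF that] B(4) by (rule holomorphic_on_subset)
    define g where "g = (\<lambda>j. if j = 0 then (\<lambda>_. 1) else (\<lambda>z. f j z / f 0 z))"
    have g: "g j holomorphic_on B" if "j < Suc k" for j
      using fB that nz by (auto simp: g_def intro!: holomorphic_intros)
    have Wg: "wronskian k (\<lambda>j. deriv (g (Suc j))) z = 0" if z: "z \<in> B" for z
    proof -
      have "0 = wronskian (Suc k) f z"
        using W z B by auto
      also have "\<dots> = wronskian (Suc k) (\<lambda>j z. f 0 z * g j z) z"
        using fB nz by (intro wronskian_cong_open[OF B(1) z]) (auto simp: g_def)
      also have "\<dots> = f 0 z ^ Suc k * wronskian (Suc k) g z"
        using wronskian_substitution[of B B "f 0" "\<lambda>z. z" "Suc k" g z] B fB g z by auto
      also have "wronskian (Suc k) g z = wronskian k (\<lambda>j. deriv (g (Suc j))) z"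
        by (rule wronskian_Suc_one) (simp add: g_def)
      finally show ?thesis
        using nz[OF z] by simp
    qed
    have "deriv (g (Suc j)) holomorphic_on B" if "j < k" for j
      using g[of "Suc j"] that B(1) by (auto intro!: holomorphic_deriv)
    from Suc.IH[OF B(1-3) this Wg] obtain c where
      c: "\<exists>j<k. c j \<noteq> 0" "\<forall>z\<in>B. (\<Sum>j<k. c j * deriv (g (Suc j)) z) = 0"
      by blast
    have "((\<lambda>z. \<Sum>j<k. c j * g (Suc j) z) has_field_derivative 0) (at z within B)"
      if z: "z \<in> B" for z
    proof -
      have "((\<lambda>z. \<Sum>j<k. c j * g (Suc j) z) has_field_derivative
              (\<Sum>j<k. c j * deriv (g (Suc j)) z)) (at z)"
        using g B(1) z by (intro DERIV_sum DERIV_cmult holomorphic_derivI) auto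
      then show ?thesis
        using c(2) z by (auto intro: has_field_derivative_at_within)
    qed
    then have "\<exists>d. \<forall>z\<in>B. (\<Sum>j<k. c j * g (Suc j) z) = d"
      unfolding B_def by (rule has_field_derivative_zero_constant[OF convex_ball])
    then obtain d where d: "\<And>z. z \<in> B \<Longrightarrow> (\<Sum>j<k. c j * g (Suc j) z) = d"
      by blast
    \<comment> \<open>The constant d becomes the coefficient of the function divided out.\<close>
    define c' where "c' = case_nat (- d) c"
    have zeroB: "(\<Sum>j<Suc k. c' j * f j z) = 0" if z: "z \<in> B" for z
    proof -
      have "(\<Sum>j<Suc k. c' j * f j z) = - d * f 0 z + (\<Sum>j<k. c j * f (Suc j) z)"
        by (subst sum.lessThan_Suc_shift) (simp add: c'_def)
      also have "(\<Sum>j<k. c j * f (Suc j) z) = f 0 z * (\<Sum>j<k. c j * g (Suc j) z)"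
        using nz[OF z] by (simp add: g_def sum_distrib_left)
      finally show ?thesis
        using d[OF z] by simp
    qed
    have "(\<Sum>j<Suc k. c' j * f j z) = 0" if "z \<in> S" for z
      by (rule analytic_continuation_open[OF B(1) S(1) B(3) S(2) B(4) _ _ zeroB that])
        (use f in \<open>auto intro!: holomorphic_intros\<close>)
    moreover have "\<exists>j<Suc k. c' j \<noteq> 0"
    proof -
      obtain j where "j < k" "c j \<noteq> 0"
        using c(1) by blast
      then show ?thesis
        by (intro exI[of _ "Suc j"]) (simp add: c'_def)
    qed
    ultimately show ?thesis
      by blast
  qed
qed

section \<open>The slash operator\<close>

lemma open_UHP: "open UHP"
  unfolding UHP_def by (rule open_halfspace_Im_gt)

lemma connected_UHP: "connected UHP"
  unfolding UHP_def by (intro convex_connected convex_halfspace_Im_gt)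

lemma autj_nonzero:
  assumes "det g = 1" "z \<in> UHP"
  shows "autj g z \<noteq> 0"
proof
  assume *: "autj g z = 0"
  then have "g $ 2 $ 1 * Im z = 0"
    by (simp add: autj_def complex_eq_iff)
  then have "g $ 2 $ 1 = 0"
    using assms(2) by (simp add: UHP_def)
  with * have "g $ 2 $ 2 = 0"
    by (simp add: autj_def)
  with \<open>g $ 2 $ 1 = 0\<close> assms(1) show False
    by (simp add: det_2)
qed

lemma mob_eq: "mob g z = (of_real (g $ 1 $ 1) * z + of_real (g $ 1 $ 2)) / autj g z"
  by (simp add: mob_def moebius_def autj_def)

lemma mob_in_UHP:
  assumes "det g = 1" "z \<in> UHP"
  shows "mob g z \<in> UHP"
proof -
  have "Im (mob g z) = det g * Im z / (cmod (autj g z))\<^sup>2"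
    by (simp add: mob_eq Im_divide cmod_power2 det_2 autj_def algebra_simps add_divide_distrib diff_divide_distrib)
  then show ?thesis
    using assms autj_nonzero[OF assms] by (simp add: UHP_def)
qed

lemma has_field_derivative_mob:
  assumes "det g = 1" "z \<in> UHP"
  shows "(mob g has_field_derivative 1 / autj g z ^ 2) (at z)"
proof -
  note nz = autj_nonzero[OF assms]
  have "of_real (g $ 1 $ 1) * of_real (g $ 2 $ 2) - of_real (g $ 1 $ 2) * of_real (g $ 2 $ 1)
          = (1 :: complex)"
    using assms(1) by (simp add: det_2 flip: of_real_mult of_real_diff)
  then have *: "of_real (g $ 1 $ 1) * autj g z
      - (of_real (g $ 1 $ 1) * z + of_real (g $ 1 $ 2)) * of_real (g $ 2 $ 1) = 1"
    by (simp add: autj_def algebra_simps)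
  have "(autj g has_field_derivative of_real (g $ 2 $ 1)) (at z)"
    unfolding autj_def[abs_def] by (auto intro!: derivative_eq_intros)
  then have "((\<lambda>z. (of_real (g $ 1 $ 1) * z + of_real (g $ 1 $ 2)) / autj g z)
     has_field_derivative (of_real (g $ 1 $ 1) * autj g z
      - (of_real (g $ 1 $ 1) * z + of_real (g $ 1 $ 2)) * of_real (g $ 2 $ 1)) / (autj g z * autj g z)) (at z)"
    using nz by (auto intro!: derivative_eq_intros)
  then show ?thesis
    unfolding * by (simp add: mob_eq[abs_def] power2_eq_square)
qed

lemma holomorphic_mob: "det g = 1 \<Longrightarrow> mob g holomorphic_on UHP"
  using has_field_derivative_mob by (auto simp: holomorphic_on_open[OF open_UHP])

lemma holomorphic_autj [holomorphic_intros]: "autj g holomorphic_on S"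
  unfolding autj_def[abs_def] by (intro holomorphic_intros)

lemma slash_holomorphic:
  assumes "det g = 1" "f holomorphic_on UHP"
  shows "slash w f g holomorphic_on UHP"
proof -
  have "f \<circ> mob g holomorphic_on UHP"
    using assms mob_in_UHP by (intro holomorphic_on_compose_gen[OF holomorphic_mob]) auto
  then show ?thesis
    using autj_nonzero[OF assms(1)]
    unfolding slash_def[abs_def] o_def by (auto intro!: holomorphic_intros)
qed

lemma autj_mult:
  assumes "det A = 1" "det B = 1" "z \<in> UHP"
  shows "autj (A ** B) z = autj A (mob B z) * autj B z"
proof -
  have "mob B z * autj B z = of_real (B $ 1 $ 1) * z + of_real (B $ 1 $ 2)"
    using autj_nonzero[OF assms(2,3)] by (simp add: mob_eq)
  moreover have "autj A (mob B z) * autj B z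
      = of_real (A $ 2 $ 1) * (mob B z * autj B z) + of_real (A $ 2 $ 2) * autj B z"
    by (simp add: autj_def[of A] algebra_simps)
  ultimately show ?thesis
    by (simp add: autj_def matrix_matrix_mult_def sum_2 algebra_simps)
qed

lemma mob_mult:
  assumes "det A = 1" "det B = 1" "z \<in> UHP"
  shows "mob (A ** B) z = mob A (mob B z)"
proof -
  note nzB = autj_nonzero[OF assms(2,3)]
  note nzA = autj_nonzero[OF assms(1) mob_in_UHP[OF assms(2,3)]]
  have "of_real ((A ** B) $ 1 $ 1) * z + of_real ((A ** B) $ 1 $ 2)
          = (of_real (A $ 1 $ 1) * mob B z + of_real (A $ 1 $ 2)) * autj B z"
    using nzB
    by (simp add: mob_eq field_simps) (simp add: autj_def matrix_matrix_mult_def sum_2 algebra_simps)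
  then show ?thesis
    using nzA nzB by (simp add: mob_eq[of "A ** B"] mob_eq[of A] autj_mult[OF assms])
qed

lemma slash_mult:
  assumes "det A = 1" "det B = 1" "z \<in> UHP"
  shows "slash w f (A ** B) z = slash w (slash w f A) B z"
  by (simp add: slash_def mob_mult[OF assms] autj_mult[OF assms] power_mult_distrib)

lemma slash_transl: "slash w f (transl h) z = f (z + of_real h)"
  by (simp add: slash_def mob_eq autj_def transl_def)

lemma det_transl: "det (transl h) = 1"
  by (simp add: det_2 transl_def)

text \<open>The slash operator is a right action in which a translation acts by shifting the argument, and
  $\sigma T = \gamma \sigma$ for $\gamma = \sigma T \sigma^{-1}$.\<close>

lemma slash_periodic:
  assumes \<sigma>: "det \<sigma> = 1" and \<gamma>: "det (\<sigma> ** transl h ** matrix_inv \<sigma>) = 1"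
    and f: "\<And>z. z \<in> UHP \<Longrightarrow> slash w f (\<sigma> ** transl h ** matrix_inv \<sigma>) z = f z"
    and z: "z \<in> UHP"
  shows "slash w f \<sigma> (z + of_real h) = slash w f \<sigma> z"
proof -
  let ?\<gamma> = "\<sigma> ** transl h ** matrix_inv \<sigma>"
  have "\<exists>\<tau>. \<sigma> ** \<tau> = mat 1 \<and> \<tau> ** \<sigma> = mat 1"
    using \<sigma> invertible_det_nz[of \<sigma>] by (simp add: invertible_def)
  then have inv: "matrix_inv \<sigma> ** \<sigma> = mat 1"
    unfolding matrix_inv_def by (rule someI2_ex) blast
  have "?\<gamma> ** \<sigma> = \<sigma> ** transl h ** (matrix_inv \<sigma> ** \<sigma>)"
    by (simp only: matrix_mul_assoc)
  then have comm: "?\<gamma> ** \<sigma> = \<sigma> ** transl h"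
    by (simp only: inv matrix_mul_rid)
  have "slash w f \<sigma> (z + of_real h) = slash w f (?\<gamma> ** \<sigma>) z"
    using slash_mult[OF \<sigma> det_transl z, of w f h] by (simp only: slash_transl comm)
  also have "\<dots> = slash w (slash w f ?\<gamma>) \<sigma> z"
    by (rule slash_mult[OF \<gamma> \<sigma> z])
  also have "\<dots> = slash w f \<sigma> z"
    using f[OF mob_in_UHP[OF \<sigma> z]] by (simp add: slash_def)
  finally show ?thesis .
qed

text \<open>The substitution rule with $u = j(\sigma, z)^{-m}$ and $\sigma' = j(\sigma, z)^{-2}$; the total
  exponent is $mk + 2(0 + 1 + \cdots + (k-1)) = k(m+k-1)$.\<close>

lemma wronskian_slash:
  assumes \<sigma>: "det \<sigma> = 1" and f: "\<And>j. j < k \<Longrightarrow> f j holomorphic_on UHP" and z: "z \<in> UHP"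
  shows "wronskian k (\<lambda>j. slash m (f j) \<sigma>) z = slash (k * (m + k - 1)) (wronskian k f) \<sigma> z"
proof -
  have gauss: "2 * (\<Sum>i<k. i) = k * (k - 1)"
  proof (induction k)
    case (Suc k)
    then show ?case
      by (cases k) (simp_all add: algebra_simps)
  qed simp
  have weight: "m * k + 2 * (\<Sum>i<k. i) = k * (m + k - 1)"
    unfolding gauss by (cases k) (simp_all add: algebra_simps)
  have u: "(\<lambda>z. 1 / autj \<sigma> z ^ m) holomorphic_on UHP"
    using autj_nonzero[OF \<sigma>] by (auto intro!: holomorphic_intros)
  have "wronskian k (\<lambda>j. slash m (f j) \<sigma>) z
          = wronskian k (\<lambda>j z. 1 / autj \<sigma> z ^ m * f j (mob \<sigma> z)) z"
    by (simp add: slash_def[abs_def])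
  also have "\<dots> = (1 / autj \<sigma> z ^ m) ^ k * (1 / autj \<sigma> z ^ 2) ^ (\<Sum>i<k. i)
                   * wronskian k f (mob \<sigma> z)"
    using wronskian_substitution[where f = f and k = k, OF open_UHP open_UHP u holomorphic_mob[OF \<sigma>] _ f z]
      mob_in_UHP[OF \<sigma>] DERIV_imp_deriv[OF has_field_derivative_mob[OF \<sigma> z]] by auto
  also have "\<dots> = wronskian k f (mob \<sigma> z) / autj \<sigma> z ^ (m * k + 2 * (\<Sum>i<k. i))"
    by (simp only: power_divide power_one power_mult[symmetric] power_add) simp
  finally show ?thesis
    unfolding weight by (simp add: slash_def)
qed

section \<open>Behaviour at the cusp at infinity\<close>

text \<open>Approach to $i\infty$, uniformly in the real part. This is stronger than convergence along each
  vertical line, and the uniformity is what lets the Cauchy estimates be applied on discs.\<close>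

abbreviation at_i_infinity :: "complex filter" where
  "at_i_infinity \<equiv> filtercomap Im at_top"

definition nome :: "real \<Rightarrow> complex \<Rightarrow> complex" where
  "nome h z = exp (2 * of_real pi * \<i> * z / of_real h)"

lemma nome_power: "nome h z ^ n = exp (2 * of_real pi * \<i> * of_nat n * z / of_real h)"
  by (simp add: nome_def exp_of_nat_mult[symmetric] mult_ac)

lemma norm_nome: "norm (nome h z) = exp (- (2 * pi / h) * Im z)"
  by (simp add: nome_def)

lemma nome_in_disc_iff: "h > 0 \<Longrightarrow> norm (nome h z) < 1 \<longleftrightarrow> z \<in> UHP"
  by (auto simp: norm_nome UHP_def zero_less_mult_iff zero_less_divide_iff)

lemma nome_add: "nome h (w + z) = nome h w * nome h z"
  by (simp add: nome_def distrib_left add_divide_distrib exp_add)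

lemma nome_tendsto_0:
  assumes "h > 0"
  shows "(nome h \<longlongrightarrow> 0) at_i_infinity"
proof (rule tendsto_norm_zero_cancel)
  have "((\<lambda>y. exp (- (2 * pi / h) * y)) \<longlongrightarrow> 0) at_top"
    using assms by real_asymp
  from filterlim_compose[OF this filterlim_filtercomap]
  show "((\<lambda>z. norm (nome h z)) \<longlongrightarrow> 0) at_i_infinity"
    by (simp add: norm_nome)
qed

lemma eventually_in_UHP: "eventually (\<lambda>z. z \<in> UHP) at_i_infinity"
  unfolding eventually_filtercomap_at_top_linorder UHP_def by (intro exI[of _ 1]) auto

text \<open>The sum of the power series is continuous at $0$, and the nome tends to $0$.\<close>

lemma fourier_series_tendsto:
  assumes h: "h > 0" and F: "\<And>z. z \<in> UHP \<Longrightarrow> (\<lambda>n. a n * nome h z ^ n) sums F z"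
  shows "(F \<longlongrightarrow> a 0) at_i_infinity"
proof -
  define P where "P = (\<lambda>q. \<Sum>n. a n * q ^ n)"
  have "\<i> \<in> UHP"
    by (simp add: UHP_def)
  then have "summable (\<lambda>n. a n * nome h \<i> ^ n)"
    using F by (auto simp: sums_iff)
  then have "isCont P 0"
    unfolding P_def by (rule isCont_powser) (simp add: nome_def)
  then have "((\<lambda>z. P (nome h z)) \<longlongrightarrow> P 0) at_i_infinity"
    by (rule isCont_tendsto_compose) (rule nome_tendsto_0[OF h])
  then have "((\<lambda>z. P (nome h z)) \<longlongrightarrow> a 0) at_i_infinity"
    unfolding P_def by simp
  then show ?thesis
    by (rule Lim_transform_eventually)
      (use eventually_in_UHP F in \<open>auto elim!: eventually_mono simp: P_def sums_iff\<close>)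
qed

text \<open>The Cauchy estimate on the disc of radius $1$ about $z$ bounds the derivative by a multiple of the
  oscillation of $F$ around $L$ on that disc, which lies as high up as desired.\<close>

lemma higher_deriv_tendsto_0:
  assumes F: "F holomorphic_on UHP" and lim: "(F \<longlongrightarrow> L) at_i_infinity" and n: "n > 0"
  shows "((deriv ^^ n) F \<longlongrightarrow> 0) at_i_infinity"
proof (rule tendstoI)
  fix e :: real assume e: "e > 0"
  then have "eventually (\<lambda>z. dist (F z) L < e / (2 * fact n)) at_i_infinity"
    using lim by (intro tendstoD) auto
  then obtain N where N: "\<And>z. Im z \<ge> N \<Longrightarrow> dist (F z) L < e / (2 * fact n)"
    unfolding eventually_filtercomap_at_top_linorder by blast
  have "dist ((deriv ^^ n) F z) 0 < e" if z: "Im z \<ge> max (N + 1) 2" for z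
  proof -
    have Im: "Im w \<ge> N" "w \<in> UHP" if "w \<in> cball z 1" for w
    proof -
      have "Im z - Im w \<le> 1"
        using abs_Im_le_cmod[of "z - w"] that by (simp add: dist_norm)
      then show "Im w \<ge> N" "w \<in> UHP"
        using z by (simp_all add: UHP_def)
    qed
    then have sub: "ball z 1 \<subseteq> UHP" "cball z 1 \<subseteq> UHP"
      using ball_subset_cball[of z 1] by blast+
    have "cmod ((deriv ^^ n) F z) \<le> fact n * (e / (2 * fact n)) / 1 ^ n"
    proof (rule Cauchy_higher_deriv_bound[where y = L])
      show "F holomorphic_on ball z 1" "continuous_on (cball z 1) F"
        using F sub holomorphic_on_subset holomorphic_on_imp_continuous_on by blast+
      show "F w \<in> ball L (e / (2 * fact n))" if "w \<in> ball z 1" for w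
        using N[OF Im(1), of w] that by (simp add: dist_commute)
    qed (use n in auto)
    then show ?thesis
      using e by simp
  qed
  then show "eventually (\<lambda>z. dist ((deriv ^^ n) F z) 0 < e) at_i_infinity"
    unfolding eventually_filtercomap_at_top_linorder by blast
qed

text \<open>In the Leibniz formula each term has a factor from row $1$, which tends to $0$, while its other
  factors have finite limits.\<close>

lemma wronskian_tendsto_0:
  assumes k: "k \<ge> 2" and F: "\<And>j. j < k \<Longrightarrow> F j holomorphic_on UHP"
    and lim: "\<And>j. j < k \<Longrightarrow> (F j \<longlongrightarrow> L j) at_i_infinity"
  shows "(wronskian k F \<longlongrightarrow> 0) at_i_infinity"
proof -
  have D: "((deriv ^^ i) (F j) \<longlongrightarrow> (if i = 0 then L j else 0)) at_i_infinity" if "j < k" for i j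
    using higher_deriv_tendsto_0[OF F[OF that] lim[OF that]] lim[OF that] by auto
  have P: "((\<lambda>z. \<Prod>i = 0..<k. (deriv ^^ i) (F (p i)) z) \<longlongrightarrow> 0) at_i_infinity"
    if p: "p permutes {0..<k}" for p
  proof -
    have "p i < k" if "i < k" for i
      using permutes_in_image[OF p, of i] that by simp
    then have "((\<lambda>z. \<Prod>i = 0..<k. (deriv ^^ i) (F (p i)) z)
              \<longlongrightarrow> (\<Prod>i = 0..<k. if i = 0 then L (p i) else 0)) at_i_infinity"
      by (intro tendsto_prod D) auto
    moreover have "(\<Prod>i = 0..<k. if i = 0 then L (p i) else 0) = 0"
      using k by (intro prod_zero) (auto intro!: bexI[of _ 1])
    ultimately show ?thesis
      by simp
  qed
  show ?thesis
    unfolding wronskian_sum_over_permutations[abs_def]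
    by (rule tendsto_null_sum) (auto intro!: tendsto_mult_right_zero P)
qed

lemma periodic_int:
  fixes G :: "complex \<Rightarrow> complex"
  assumes "\<And>z. z \<in> UHP \<Longrightarrow> G (z + of_real h) = G z" "z \<in> UHP"
  shows "G (z + of_int n * of_real h) = G z"
proof -
  have nat: "G (z + of_nat n * of_real h) = G z" if "z \<in> UHP" for n z
  proof (induction n)
    case (Suc n)
    have "z + of_nat n * of_real h \<in> UHP"
      using that by (simp add: UHP_def)
    from assms(1)[OF this] Suc show ?case
      by (simp add: algebra_simps)
  qed simp
  show ?thesis
  proof (cases n)
    case (nonneg m)
    then show ?thesis
      using nat[OF assms(2)] by simp
  next
    case (neg m)
    have "z + of_int n * of_real h \<in> UHP"
      using assms(2) by (simp add: UHP_def)
    from nat[OF this, of "Suc m"] show ?thesis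
      by (simp add: neg algebra_simps)
  qed
qed

text \<open>Periodicity lets $G$ descend along the nome to the punctured unit disc. The value $L$ at the
  centre makes the result continuous, so the singularity is removable and the Taylor series at $0$
  is the required expansion.\<close>

lemma fourier_series_of_periodic:
  assumes h: "h > 0" and G: "G holomorphic_on UHP"
    and per: "\<And>z. z \<in> UHP \<Longrightarrow> G (z + of_real h) = G z"
    and lim: "(G \<longlongrightarrow> L) at_i_infinity"
  obtains a where "a 0 = L" "\<And>z. z \<in> UHP \<Longrightarrow> (\<lambda>n. a n * nome h z ^ n) sums G z"
proof -
  define ell where "ell = (\<lambda>q. of_real h / (2 * of_real pi * \<i>) * Ln q)"
  define \<Phi> where "\<Phi> = (\<lambda>q. if q = 0 then L else G (ell q))"
  have nome_ell: "nome h (ell q) = q" if "q \<noteq> 0" for q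
    using that h by (simp add: nome_def ell_def)
  have Im_ell: "Im (ell q) = - (h / (2 * pi)) * ln (norm q)" if "q \<noteq> 0" for q
    using that h by (simp add: ell_def Im_divide Re_Ln power2_eq_square field_simps)
  have \<Phi>_nome: "\<Phi> (nome h z) = G z" if z: "z \<in> UHP" for z
  proof -
    have "exp (2 * of_real pi * \<i> * ell (nome h z) / of_real h)
            = exp (2 * of_real pi * \<i> * z / of_real h)"
      using nome_ell[of "nome h z"] by (simp add: nome_def)
    then obtain n :: int where n: "2 * of_real pi * \<i> * ell (nome h z) / of_real h
            = 2 * of_real pi * \<i> * z / of_real h + (of_int (2 * n) * pi) * \<i>"
      unfolding exp_eq by blast
    then have "2 * of_real pi * \<i> * ell (nome h z)
                 = 2 * of_real pi * \<i> * (z + of_int n * of_real h)"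
      using h by (simp add: field_simps)
    then have "ell (nome h z) = z + of_int n * of_real h"
      by simp
    then have "G (ell (nome h z)) = G z"
      using periodic_int[of G h, OF per z] by simp
    then show ?thesis
      by (simp add: \<Phi>_def nome_def)
  qed
  have hol: "\<Phi> holomorphic_on ball 0 1 - {0}"
    unfolding holomorphic_on_open[OF open_delete[OF open_ball]]
  proof
    fix q0 :: complex assume q0: "q0 \<in> ball 0 1 - {0}"
    \<comment> \<open>The principal logarithm jumps on the negative axis, so near q0 the inverse of the nome is
      taken along the branch of Ln (q / q0), which is holomorphic on the disc of radius |q0|.\<close>
    define U where "U = ball q0 (norm q0) \<inter> ball 0 1"
    define \<psi> where "\<psi> = (\<lambda>q. ell q0 + ell (q / q0))"
    have U: "q \<noteq> 0" "q / q0 \<notin> \<real>\<^sub>\<le>\<^sub>0" "norm q < 1" if "q \<in> U" for q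
    proof -
      from that have *: "norm (q0 - q) < norm q0" "norm q < 1"
        by (auto simp: U_def dist_norm)
      then show "q \<noteq> 0" "norm q < 1"
        by auto
      have "norm (1 - q / q0) = norm (q0 - q) / norm q0"
        using q0 by (simp add: norm_divide[symmetric] field_simps)
      also have "\<dots> < 1"
        using * q0 by simp
      finally have "Re (q / q0) > 0"
        using complex_Re_le_cmod[of "1 - q / q0"] by (simp del: Re_divide)
      then show "q / q0 \<notin> \<real>\<^sub>\<le>\<^sub>0"
        by (auto simp: complex_nonpos_Reals_iff)
    qed
    have nome_\<psi>: "nome h (\<psi> q) = q" if "q \<in> U" for q
      using U[OF that] q0 by (simp add: \<psi>_def nome_add nome_ell)
    have \<psi>_UHP: "\<psi> q \<in> UHP" if "q \<in> U" for q
      using U[OF that] nome_\<psi>[OF that] nome_in_disc_iff[OF h, of "\<psi> q"] by simp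
    have "\<psi> holomorphic_on U"
      unfolding \<psi>_def ell_def using U q0 by (auto intro!: holomorphic_intros)
    then have "G \<circ> \<psi> holomorphic_on U"
      using \<psi>_UHP by (intro holomorphic_on_compose_gen[OF _ G]) auto
    then have "\<Phi> holomorphic_on U"
      by (rule holomorphic_transform) (use \<Phi>_nome[OF \<psi>_UHP] nome_\<psi> in simp)
    moreover have "open U" "q0 \<in> U"
      using q0 by (auto simp: U_def)
    ultimately show "\<exists>D. (\<Phi> has_field_derivative D) (at q0)"
      using holomorphic_derivI by blast
  qed
  have cont: "(\<Phi> \<longlongrightarrow> \<Phi> 0) (at 0)"
  proof -
    have "filterlim (\<lambda>q::complex. norm q) (at_right 0) (at 0)"
      by (auto simp: filterlim_at intro!: tendsto_norm_zero tendsto_ident_at)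
        (simp add: eventually_at_filter)
    moreover have "filterlim (\<lambda>x. - (h / (2 * pi)) * ln x) at_top (at_right 0)"
      using h by real_asymp
    ultimately have "filterlim (\<lambda>q::complex. - (h / (2 * pi)) * ln (norm q)) at_top (at 0)"
      by (rule filterlim_compose[rotated])
    then have "filterlim (\<lambda>q. Im (ell q)) at_top (at 0)"
      by (rule filterlim_mono_eventually[OF _ order.refl order.refl])
         (use Im_ell in \<open>auto simp: eventually_at_filter\<close>)
    then have "filterlim ell at_i_infinity (at 0)"
      by (simp add: filterlim_filtercomap_iff o_def)
    then have "((\<lambda>q. G (ell q)) \<longlongrightarrow> L) (at 0)"
      by (rule filterlim_compose[OF lim])
    then have "(\<Phi> \<longlongrightarrow> L) (at 0)"
      by (rule Lim_transform_eventually) (auto simp: \<Phi>_def eventually_at_filter)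
    then show ?thesis
      by (simp add: \<Phi>_def)
  qed
  have \<Phi>: "\<Phi> holomorphic_on ball 0 1"
    by (rule no_isolated_singularity'[OF _ hol]) (use tendsto_within_subset[OF cont] in auto)
  show ?thesis
  proof
    show "(deriv ^^ 0) \<Phi> 0 / fact 0 = L"
      by (simp add: \<Phi>_def)
    show "(\<lambda>n. (deriv ^^ n) \<Phi> 0 / fact n * nome h z ^ n) sums G z" if z: "z \<in> UHP" for z
      using holomorphic_power_series[OF \<Phi>, of "nome h z"] z \<Phi>_nome[OF z] nome_in_disc_iff[OF h]
      by simp
  qed
qed

section \<open>The Wronskian of modular forms\<close>

lemma fourier_expansion_nome:
  "fourier_expansion m \<Gamma> chi f \<sigma> h a \<longleftrightarrow>
     h > 0 \<and> \<sigma> ** transl h ** matrix_inv \<sigma> \<in> {\<gamma> \<in> \<Gamma>. chi \<gamma> = 1} \<and>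
     (\<forall>z\<in>UHP. (\<lambda>n. a n * nome h z ^ n) sums slash m f \<sigma> z)"
  by (simp add: fourier_expansion_def nome_power)

lemma wronskian_modular_transformation:
  assumes \<gamma>: "det \<gamma> = 1" and f: "\<And>j. j < k \<Longrightarrow> f j holomorphic_on UHP"
    and tr: "\<And>j z. j < k \<Longrightarrow> z \<in> UHP \<Longrightarrow> f j (mob \<gamma> z) = c * autj \<gamma> z ^ m * f j z"
    and z: "z \<in> UHP"
  shows "slash (k * (m + k - 1)) (wronskian k f) \<gamma> z = c ^ k * wronskian k f z"
proof -
  have "slash (k * (m + k - 1)) (wronskian k f) \<gamma> z = wronskian k (\<lambda>j. slash m (f j) \<gamma>) z"
    using wronskian_slash[OF \<gamma> f z] by simp
  also have "\<dots> = wronskian k (\<lambda>j z. c * f j z) z"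
    using tr f autj_nonzero[OF \<gamma>]
    by (intro wronskian_cong_open[OF open_UHP z] slash_holomorphic[OF \<gamma>]) (auto simp: slash_def)
  also have "\<dots> = c ^ k * wronskian k f z"
    by (rule wronskian_scale[OF open_UHP z f])
  finally show ?thesis .
qed

lemma wronskian_vanishes_at_cusp:
  assumes \<Gamma>: "\<And>\<gamma>. \<gamma> \<in> \<Gamma> \<Longrightarrow> det \<gamma> = 1"
    and k: "k \<ge> 2"
    and f: "\<And>j. j < k \<Longrightarrow> f j \<in> modular_forms m \<Gamma> chi"
    and x: "x \<in> cusps \<Gamma>"
  shows "vanishes_at_cusp (k * (m + k - 1)) \<Gamma> (\<lambda>\<gamma>. chi \<gamma> ^ k) (wronskian k f) x"
  unfolding vanishes_at_cusp_def
proof (intro ballI impI)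
  fix \<sigma> assume "\<sigma> \<in> carrier SL2R" and \<sigma>x: "bdry_act \<sigma> None = x"
  then have \<sigma>: "det \<sigma> = 1"
    by (simp add: SL2R_def)
  have hol: "f j holomorphic_on UHP" if "j < k" for j
    using f[OF that] by (simp add: modular_forms_def)
  have "\<exists>h a. fourier_expansion m \<Gamma> chi (f j) \<sigma> h a" if "j < k" for j
    using f[OF that] x \<sigma>x \<open>\<sigma> \<in> carrier SL2R\<close>
    by (auto simp: modular_forms_def holomorphic_at_cusp_def)
  then obtain h a where ha: "\<And>j. j < k \<Longrightarrow> fourier_expansion m \<Gamma> chi (f j) \<sigma> (h j) (a j)"
    by metis
  \<comment> \<open>The functions may come with different periods; one of them suffices, since the
    transformation law gives the periodicity of the Wronskian.\<close>
  define H where "H = h 0"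
  define \<gamma> where "\<gamma> = \<sigma> ** transl H ** matrix_inv \<sigma>"
  have H: "H > 0" and \<gamma>: "\<gamma> \<in> \<Gamma>" "chi \<gamma> = 1"
    using ha[of 0] k by (auto simp: fourier_expansion_nome H_def \<gamma>_def)
  let ?w = "k * (m + k - 1)"
  let ?G = "slash ?w (wronskian k f) \<sigma>"
  have "(slash m (f j) \<sigma> \<longlongrightarrow> a j 0) at_i_infinity" if "j < k" for j
    using ha[OF that] by (intro fourier_series_tendsto[of "h j"]) (auto simp: fourier_expansion_nome)
  then have "(wronskian k (\<lambda>j. slash m (f j) \<sigma>) \<longlongrightarrow> 0) at_i_infinity"
    by (intro wronskian_tendsto_0[OF k] slash_holomorphic[OF \<sigma> hol])
  then have lim: "(?G \<longlongrightarrow> 0) at_i_infinity"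
    by (rule Lim_transform_eventually)
      (use eventually_in_UHP wronskian_slash[OF \<sigma> hol] in \<open>auto elim!: eventually_mono\<close>)
  have "slash ?w (wronskian k f) \<gamma> z = chi \<gamma> ^ k * wronskian k f z" if "z \<in> UHP" for z
    using f \<gamma>(1) by (intro wronskian_modular_transformation[OF \<Gamma>[OF \<gamma>(1)] hol _ that])
      (auto simp: modular_forms_def)
  then have per: "?G (z + of_real H) = ?G z" if "z \<in> UHP" for z
    using that \<Gamma>[OF \<gamma>(1)] \<gamma>(2) by (intro slash_periodic[OF \<sigma>]) (auto simp flip: \<gamma>_def)
  have "?G holomorphic_on UHP"
    by (intro slash_holomorphic[OF \<sigma>] wronskian_holomorphic open_UHP hol)
  from fourier_series_of_periodic[OF H this per lim] obtain b where
    "b 0 = 0" "\<And>z. z \<in> UHP \<Longrightarrow> (\<lambda>n. b n * nome H z ^ n) sums ?G z"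
    by blast
  then have "fourier_expansion ?w \<Gamma> (\<lambda>\<gamma>. chi \<gamma> ^ k) (wronskian k f) \<sigma> H b \<and> b 0 = 0"
    using H \<gamma> by (auto simp: fourier_expansion_nome \<gamma>_def)
  then show "\<exists>h a. fourier_expansion ?w \<Gamma> (\<lambda>\<gamma>. chi \<gamma> ^ k) (wronskian k f) \<sigma> h a \<and> a 0 = 0"
    by blast
qed

theorem proposition6p2:
  fixes \<Gamma> :: "(real ^ 2 ^ 2) set"
    and chi :: "real ^ 2 ^ 2 \<Rightarrow> complex"
    and m k :: nat
    and f :: "nat \<Rightarrow> complex \<Rightarrow> complex"
  assumes "fuchsian_first_kind \<Gamma>"
    and "finite_order_character \<Gamma> chi"
    and "m \<ge> 1"
    and "k \<ge> 1"
    and "\<And>j. j < k \<Longrightarrow> f j \<in> modular_forms m \<Gamma> chi"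
  shows "(k \<ge> 2 \<longrightarrow> wronskian k f \<in> cusp_forms (k * (m + k - 1)) \<Gamma> (\<lambda>\<gamma>. chi \<gamma> ^ k)) \<and>
         (lin_indep_on_UHP k f \<longrightarrow> (\<exists>z\<in>UHP. wronskian k f z \<noteq> 0))"
proof (intro conjI impI)
  have \<Gamma>: "det \<gamma> = 1" if "\<gamma> \<in> \<Gamma>" for \<gamma>
    using assms(1) that subgroup.subset[of \<Gamma> SL2R] by (auto simp: fuchsian_first_kind_def SL2R_def)
  have hol: "f j holomorphic_on UHP" if "j < k" for j
    using assms(5)[OF that] by (simp add: modular_forms_def)
  show "wronskian k f \<in> cusp_forms (k * (m + k - 1)) \<Gamma> (\<lambda>\<gamma>. chi \<gamma> ^ k)" if "k \<ge> 2"
  proof -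
    let ?w = "k * (m + k - 1)"
    have "wronskian k f (mob \<gamma> z) = chi \<gamma> ^ k * autj \<gamma> z ^ ?w * wronskian k f z"
      if \<gamma>: "\<gamma> \<in> \<Gamma>" and z: "z \<in> UHP" for \<gamma> z
    proof -
      have "slash ?w (wronskian k f) \<gamma> z = chi \<gamma> ^ k * wronskian k f z"
        using assms(5) \<gamma> by (intro wronskian_modular_transformation[OF \<Gamma>[OF \<gamma>] hol _ z])
          (auto simp: modular_forms_def)
      then show ?thesis
        using autj_nonzero[OF \<Gamma>[OF \<gamma>] z] by (simp add: slash_def field_simps)
    qed
    moreover have van: "vanishes_at_cusp ?w \<Gamma> (\<lambda>\<gamma>. chi \<gamma> ^ k) (wronskian k f) x"
      if "x \<in> cusps \<Gamma>" for x
      using wronskian_vanishes_at_cusp[OF \<Gamma> \<open>k \<ge> 2\<close> assms(5) that] .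
    moreover have "holomorphic_at_cusp ?w \<Gamma> (\<lambda>\<gamma>. chi \<gamma> ^ k) (wronskian k f) x"
      if "x \<in> cusps \<Gamma>" for x
      using van[OF that] unfolding vanishes_at_cusp_def holomorphic_at_cusp_def by blast
    ultimately show ?thesis
      using wronskian_holomorphic[OF open_UHP hol]
      by (simp add: cusp_forms_def modular_forms_def)
  qed
  show "\<exists>z\<in>UHP. wronskian k f z \<noteq> 0" if "lin_indep_on_UHP k f"
  proof (rule ccontr)
    assume "\<not> ?thesis"
    moreover have "\<i> \<in> UHP"
      by (simp add: UHP_def)
    ultimately obtain c where "\<exists>j<k. c j \<noteq> 0" "\<forall>z\<in>UHP. (\<Sum>j<k. c j * f j z) = 0"
      using wronskian_eq_0_imp_dependent[where f = f and k = k, OF open_UHP connected_UHP _ hol] by blast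
    with that show False
      by (auto simp: lin_indep_on_UHP_def)
  qed
qed

end
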